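(* Let $p = p_0 + p_1\mathbf{i} + p_2\mathbf{j} + p_3\mathbf{k}$ and $q = q_0 + q_1\mathbf{i} + q_2\mathbf{j} + q_3\mathbf{k}$ be quaternions, where $p_0,p_1,p_2,p_3,q_0,q_1,q_2,q_3 \in \mathbb{R}$. Then $$pq^* + qp^* = p^*q + q^*p = 2p_0q_0 + 2p_1q_1 + 2p_2q_2 + 2p_3q_3,$$ which is a real number.
   Context: $\mathbf{i},\mathbf{j},\mathbf{k}$ are the imaginary units of the (real Hamilton) quaternions, with $\mathbf{i}^2=\mathbf{j}^2=\mathbf{k}^2=\mathbf{i}\mathbf{j}\mathbf{k}=-1$. The conjugate of $q = q_0 + q_1\mathbf{i} + q_2\mathbf{j} + q_3\mathbf{k}$ is $q^* = q_0 - q_1\mathbf{i} - q_2\mathbf{j} - q_3\mathbf{k}$. *)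

theory Defs
  imports Complex_Main
begin

text \<open>Real Hamilton quaternions as a real algebra. The coefficients of \<open>1, i, j, k\<close> are
  stored in this order.\<close>

datatype quat = Quat (qcoeff0: real) (qcoeff1: real) (qcoeff2: real) (qcoeff3: real)

lemma quat_eq_iff:
  "x = y \<longleftrightarrow> qcoeff0 x = qcoeff0 y \<and> qcoeff1 x = qcoeff1 y \<and>
     qcoeff2 x = qcoeff2 y \<and> qcoeff3 x = qcoeff3 y"
  by (auto intro: quat.expand)

instantiation quat :: ab_group_add
begin

definition zero_quat :: quat
  where "0 = Quat 0 0 0 0"

definition plus_quat :: "quat \<Rightarrow> quat \<Rightarrow> quat"
  where "x + y = Quat (qcoeff0 x + qcoeff0 y) (qcoeff1 x + qcoeff1 y)
                      (qcoeff2 x + qcoeff2 y) (qcoeff3 x + qcoeff3 y)"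

definition uminus_quat :: "quat \<Rightarrow> quat"
  where "- x = Quat (- qcoeff0 x) (- qcoeff1 x) (- qcoeff2 x) (- qcoeff3 x)"

definition minus_quat :: "quat \<Rightarrow> quat \<Rightarrow> quat"
  where "x - y = Quat (qcoeff0 x - qcoeff0 y) (qcoeff1 x - qcoeff1 y)
                      (qcoeff2 x - qcoeff2 y) (qcoeff3 x - qcoeff3 y)"

instance
  by standard
    (simp_all add: quat_eq_iff zero_quat_def plus_quat_def uminus_quat_def minus_quat_def)

end

text \<open>The product is the bilinear extension of \<open>ij = -ji = k\<close>, \<open>jk = -kj = i\<close>,
  \<open>ki = -ik = j\<close> and \<open>ii = jj = kk = -1\<close>; see \<open>quat_units_mult\<close> below.\<close>

instantiation quat :: real_algebra_1
begin

definition one_quat :: quat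
  where "1 = Quat 1 0 0 0"

definition times_quat :: "quat \<Rightarrow> quat \<Rightarrow> quat"
  where "x * y = Quat
    (qcoeff0 x * qcoeff0 y - qcoeff1 x * qcoeff1 y - qcoeff2 x * qcoeff2 y - qcoeff3 x * qcoeff3 y)
    (qcoeff0 x * qcoeff1 y + qcoeff1 x * qcoeff0 y + qcoeff2 x * qcoeff3 y - qcoeff3 x * qcoeff2 y)
    (qcoeff0 x * qcoeff2 y - qcoeff1 x * qcoeff3 y + qcoeff2 x * qcoeff0 y + qcoeff3 x * qcoeff1 y)
    (qcoeff0 x * qcoeff3 y + qcoeff1 x * qcoeff2 y - qcoeff2 x * qcoeff1 y + qcoeff3 x * qcoeff0 y)"

definition scaleR_quat :: "real \<Rightarrow> quat \<Rightarrow> quat"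
  where "r *\<^sub>R x = Quat (r * qcoeff0 x) (r * qcoeff1 x) (r * qcoeff2 x) (r * qcoeff3 x)"

instance
  by standard
    (simp_all add: quat_eq_iff zero_quat_def one_quat_def plus_quat_def times_quat_def
      scaleR_quat_def algebra_simps)

end

definition quat_i :: quat where "quat_i = Quat 0 1 0 0"
definition quat_j :: quat where "quat_j = Quat 0 0 1 0"
definition quat_k :: quat where "quat_k = Quat 0 0 0 1"

definition qcnj :: "quat \<Rightarrow> quat"
  where "qcnj x = Quat (qcoeff0 x) (- qcoeff1 x) (- qcoeff2 x) (- qcoeff3 x)"

lemma quat_units_mult:
  "quat_i * quat_i = - 1" "quat_j * quat_j = - 1" "quat_k * quat_k = - 1"
  "quat_i * quat_j * quat_k = - 1"
  "quat_i * quat_j = quat_k" "quat_j * quat_k = quat_i" "quat_k * quat_i = quat_j"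
  "quat_j * quat_i = - quat_k" "quat_k * quat_j = - quat_i" "quat_i * quat_k = - quat_j"
  by (simp_all add: quat_i_def quat_j_def quat_k_def one_quat_def uminus_quat_def times_quat_def)

lemma Quat_eq:
  "Quat a b c d = of_real a + b *\<^sub>R quat_i + c *\<^sub>R quat_j + d *\<^sub>R quat_k"
  by (simp add: of_real_def quat_i_def quat_j_def quat_k_def one_quat_def plus_quat_def
      scaleR_quat_def)

lemma qcnj_eq:
  "qcnj (of_real a + b *\<^sub>R quat_i + c *\<^sub>R quat_j + d *\<^sub>R quat_k) =
     of_real a - b *\<^sub>R quat_i - c *\<^sub>R quat_j - d *\<^sub>R quat_k"
  unfolding Quat_eq[symmetric]
  by (simp add: qcnj_def of_real_def quat_i_def quat_j_def quat_k_def one_quat_def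
      minus_quat_def scaleR_quat_def)

end

theory Submission
  imports Defs
begin

text \<open>The quaternion \<open>q p\<^sup>*\<close> is the conjugate of \<open>p q\<^sup>*\<close>, so their sum is twice the real part of
  \<open>p q\<^sup>*\<close>, and that real part is the Euclidean inner product of the coefficient vectors. Conjugation
  is an involution that preserves this inner product, since it flips the last three signs in both
  arguments. Applying the formula to \<open>p\<^sup>*\<close> and \<open>q\<^sup>*\<close> therefore gives \<open>p\<^sup>* q + q\<^sup>* p\<close> the same
  value.\<close>

lemma of_real_quat: "of_real r = Quat r 0 0 0"
  by (simp add: of_real_def one_quat_def scaleR_quat_def)

text \<open>In each imaginary coefficient, conjugating the second factor makes the product antisymmetric
  in \<open>x\<close> and \<open>y\<close>, so only the symmetric real coefficient survives in the sum.\<close>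

lemma mult_qcnj_symmetrized:
  "x * qcnj y + y * qcnj x =
     of_real (2 * qcoeff0 x * qcoeff0 y + 2 * qcoeff1 x * qcoeff1 y
       + 2 * qcoeff2 x * qcoeff2 y + 2 * qcoeff3 x * qcoeff3 y)"
  by (simp add: of_real_quat qcnj_def times_quat_def plus_quat_def)

lemma qcnj_mult_symmetrized:
  "qcnj x * y + qcnj y * x =
     of_real (2 * qcoeff0 x * qcoeff0 y + 2 * qcoeff1 x * qcoeff1 y
       + 2 * qcoeff2 x * qcoeff2 y + 2 * qcoeff3 x * qcoeff3 y)"
  using mult_qcnj_symmetrized[of "qcnj x" "qcnj y"] by (simp add: qcnj_def)

theorem theorem4p2:
  fixes p q :: quat and p0 p1 p2 p3 q0 q1 q2 q3 :: real
  assumes "p = of_real p0 + p1 *\<^sub>R quat_i + p2 *\<^sub>R quat_j + p3 *\<^sub>R quat_k"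
    and "q = of_real q0 + q1 *\<^sub>R quat_i + q2 *\<^sub>R quat_j + q3 *\<^sub>R quat_k"
  shows "p * qcnj q + q * qcnj p = qcnj p * q + qcnj q * p
    \<and> qcnj p * q + qcnj q * p = of_real (2 * p0 * q0 + 2 * p1 * q1 + 2 * p2 * q2 + 2 * p3 * q3)
    \<and> p * qcnj q + q * qcnj p \<in> \<real>"
proof -
  have "p = Quat p0 p1 p2 p3" "q = Quat q0 q1 q2 q3"
    using assms by (simp_all only: Quat_eq)
  then show ?thesis
    by (simp only: mult_qcnj_symmetrized qcnj_mult_symmetrized quat.sel Reals_of_real simp_thms)
qed

end
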